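(* Let $f\in\mathcal H_E$. Then $$\|f\|_{\mathcal H_E}^2=\frac12\left(\int_V\big(P(f^2)-P(f)^2\big)\,d\nu+\int_V\big(P(f)-f\big)^2\,d\nu\right)=\frac12\left(\int_V\big(P(f^2)-P(f)^2\big)\,d\nu+\|f-P(f)\|_{L^2(\nu)}^2\right).$$ In particular, both integrals on the right-hand side are finite and non-negative. Moreover, $\mathrm{Var}_x(f\circ X_1)=P(f^2)-P(f)^2\ge0$ and $\mathrm{Var}_x(f\circ X_1)\in L^1(\nu)$ for any $f\in\mathcal H_E$.
   Context: $(V,\mathcal B,\mu)$ is a standard Borel space with a non-atomic infinite $\sigma$-finite measure $\mu$. $\rho$ is a $\sigma$-finite symmetric measure on $(V\times V,\mathcal B\times\mathcal B)$, i.e. $\rho(A\times B)=\rho(B\times A)$ for all $A,B\in\mathcal B$, supported by a symmetric Borel set $E\subset V\times V$, and disintegrated with respect to $\mu$: there is a measurable family $x\mapsto\rho_x$ of measures on $(V,\mathcal B)$, with $\rho_x$ supported by $E_x=\{y:(x,y)\in E\}$, such that $\iint f\,d\rho=\int_V\big(\int_V f(x,y)\,d\rho_x(y)\big)d\mu(x)$. The measure $\rho$ is irreducible: for $\mu$-a.e. $x$, $E_x$ is nonempty and uncountable and $(E_x,\rho_x)$ is a standard (non-atomic) measure space. Put $c(x)=\rho_x(V)$; it is assumed that $0<c(x)<\infty$ for $\mu$-a.e. $x$ and $\int_A c\,d\mu<\infty$ whenever $\mu(A)<\infty$. The measure $\nu$ is $d\nu=c\,d\mu$. The Markov operator is $P(f)(x)=\int_V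 f(y)\,P(x,dy)$, with probability measures $P(x,dy)=c(x)^{-1}d\rho_x(y)$. The finite energy space $\mathcal H_E$ consists of Borel functions $f:V\to\mathbb R$, modulo constants, with $\|f\|_{\mathcal H_E}^2=\frac12\iint_{V\times V}(f(x)-f(y))^2\,d\rho(x,y)<\infty$. $X_1$ is the first step of the Markov process started at $x$: under $\mathbb P_x$, $X_1$ has distribution $P(x,\cdot)$; $\mathrm{Var}_x$ is the variance with respect to $\mathbb P_x$, i.e. $\mathrm{Var}_x(f\circ X_1)=\int_V(P(f)(x)-f(y))^2\,P(x,dy)$. *)

theory Defs
  imports "HOL-Probability.Probability"
begin

definition standard_borel :: "'a measure \<Rightarrow> bool" where
  "standard_borel M \<longleftrightarrow> (\<exists>T. topspace T = space M \<and> completely_metrizable_space T \<and>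
     second_countable T \<and> sets M = sigma_sets (space M) {U. openin T U})"

definition atom_of :: "'a measure \<Rightarrow> 'a set \<Rightarrow> bool" where
  "atom_of M A \<longleftrightarrow> A \<in> sets M \<and> emeasure M A > 0 \<and>
     (\<forall>B\<in>sets M. B \<subseteq> A \<longrightarrow> emeasure M B = 0 \<or> emeasure M (A - B) = 0)"

definition non_atomic :: "'a measure \<Rightarrow> bool" where
  "non_atomic M \<longleftrightarrow> (\<nexists>A. atom_of M A)"

text \<open>Here \<open>R x\<close> is the fibre measure \<open>\<rho>\<^sub>x\<close>, a measure on all of \<open>V\<close>.\<close>

definition total_conductance :: "('a \<Rightarrow> 'a measure) \<Rightarrow> 'a \<Rightarrow> ennreal" where
  "total_conductance R x = emeasure (R x) (space (R x))"

locale symmetric_disintegrated_measure =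
  fixes \<mu> :: "'a measure" and \<rho> :: "('a \<times> 'a) measure"
    and E :: "('a \<times> 'a) set" and R :: "'a \<Rightarrow> 'a measure"
  assumes mu_standard: "standard_borel \<mu>"
    and mu_sigma_finite: "sigma_finite_measure \<mu>"
    and mu_non_atomic: "non_atomic \<mu>"
    and mu_infinite: "emeasure \<mu> (space \<mu>) = \<infinity>"
    and rho_sets: "sets \<rho> = sets (\<mu> \<Otimes>\<^sub>M \<mu>)"
    and rho_sigma_finite: "sigma_finite_measure \<rho>"
    and rho_symmetric:
      "\<And>A B. A \<in> sets \<mu> \<Longrightarrow> B \<in> sets \<mu> \<Longrightarrow> emeasure \<rho> (A \<times> B) = emeasure \<rho> (B \<times> A)"
    and E_sets: "E \<in> sets (\<mu> \<Otimes>\<^sub>M \<mu>)"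
    and E_sym: "sym E"
    and rho_support: "emeasure \<rho> (space \<rho> - E) = 0"
    and R_sets: "\<And>x. x \<in> space \<mu> \<Longrightarrow> sets (R x) = sets \<mu>"
    and R_measurable: "\<And>B. B \<in> sets \<mu> \<Longrightarrow> (\<lambda>x. emeasure (R x) B) \<in> borel_measurable \<mu>"
    and R_support: "\<And>x. x \<in> space \<mu> \<Longrightarrow> emeasure (R x) (space \<mu> - E `` {x}) = 0"
    and disintegration:
      "\<And>f :: 'a \<times> 'a \<Rightarrow> ennreal. f \<in> borel_measurable (\<mu> \<Otimes>\<^sub>M \<mu>) \<Longrightarrow>
         (\<integral>\<^sup>+ z. f z \<partial>\<rho>) = (\<integral>\<^sup>+ x. (\<integral>\<^sup>+ y. f (x, y) \<partial>R x) \<partial>\<mu>)"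
    and irreducible:
      "AE x in \<mu>. E `` {x} \<noteq> {} \<and> uncountable (E `` {x}) \<and>
         standard_borel (restrict_space (R x) (E `` {x})) \<and>
         sigma_finite_measure (restrict_space (R x) (E `` {x})) \<and>
         non_atomic (restrict_space (R x) (E `` {x}))"
    and conductance_pos_finite:
      "AE x in \<mu>. 0 < total_conductance R x \<and> total_conductance R x < \<infinity>"
    and conductance_locally_finite:
      "\<And>A. A \<in> sets \<mu> \<Longrightarrow> emeasure \<mu> A < \<infinity> \<Longrightarrow>
         (\<integral>\<^sup>+ x\<in>A. total_conductance R x \<partial>\<mu>) < \<infinity>"

definition nu :: "'a measure \<Rightarrow> ('a \<Rightarrow> 'a measure) \<Rightarrow> 'a measure" where
  "nu \<mu> R = density \<mu> (total_conductance R)"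

text \<open>On the exceptional null set where the total conductance is \<open>0\<close> or \<open>\<infinity>\<close>, the
  measure below is the zero measure; elsewhere it is a probability measure.\<close>

definition transition :: "('a \<Rightarrow> 'a measure) \<Rightarrow> 'a \<Rightarrow> 'a measure" where
  "transition R x = scale_measure (inverse (total_conductance R x)) (R x)"

definition markov_op :: "('a \<Rightarrow> 'a measure) \<Rightarrow> ('a \<Rightarrow> real) \<Rightarrow> 'a \<Rightarrow> real" where
  "markov_op R f x = (\<integral>y. f y \<partial>transition R x)"

definition energy :: "('a \<times> 'a) measure \<Rightarrow> ('a \<Rightarrow> real) \<Rightarrow> ennreal" where
  "energy \<rho> f = (1 / 2) * (\<integral>\<^sup>+ (x, y). ennreal ((f x - f y)\<^sup>2) \<partial>\<rho>)"

text \<open>Elements of the finite energy space, which consists of classes modulo constants, are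
  represented by functions; \<open>energy_add_const\<close> shows that the energy is well defined on classes.\<close>

definition finite_energy_space :: "'a measure \<Rightarrow> ('a \<times> 'a) measure \<Rightarrow> ('a \<Rightarrow> real) set" where
  "finite_energy_space \<mu> \<rho> = {f \<in> borel_measurable \<mu>. energy \<rho> f < \<infinity>}"

definition energy_norm :: "('a \<times> 'a) measure \<Rightarrow> ('a \<Rightarrow> real) \<Rightarrow> real" where
  "energy_norm \<rho> f = sqrt (enn2real (energy \<rho> f))"

lemma energy_add_const: "energy \<rho> (\<lambda>x. f x + k) = energy \<rho> f"
  by (simp add: energy_def)

definition L2_norm :: "'a measure \<Rightarrow> ('a \<Rightarrow> real) \<Rightarrow> real" where
  "L2_norm M g = sqrt (\<integral>x. \<bar>g x\<bar>\<^sup>2 \<partial>M)"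

text \<open>An arbitrary realisation of the first step: \<open>Pr x\<close> is the law of the process started at
  \<open>x\<close>. Since \<open>Pr x\<close> is unconstrained on a null set, functions such as \<open>x \<mapsto> Var\<^sub>x\<close> are
  only measurable with respect to the completed measure.\<close>

definition first_step ::
    "'a measure \<Rightarrow> ('a \<Rightarrow> 'a measure) \<Rightarrow> ('a \<Rightarrow> 'w measure) \<Rightarrow> ('w \<Rightarrow> 'a) \<Rightarrow> bool" where
  "first_step \<mu> R Pr X1 \<longleftrightarrow>
     (AE x in \<mu>. prob_space (Pr x) \<and> X1 \<in> measurable (Pr x) \<mu> \<and>
        distr (Pr x) \<mu> X1 = transition R x)"

end

theory Submission
  imports Defs
begin

text \<open>Write \<open>D x\<close> for the mean of \<open>(f x - f y)\<^sup>2\<close> under the transition probability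
  \<open>P(x, dy)\<close>. Since \<open>c(x) P(x, dy)\<close> is the fibre measure \<open>\<rho>\<^sub>x\<close>, integrating \<open>D\<close> against
  \<open>d\<nu> = c d\<mu>\<close> and undoing the disintegration returns twice the energy of \<open>f\<close>
  (\<open>nn_integral_transition_square\<close>). For fixed \<open>x\<close>, \<open>D x\<close> is the second moment of
  \<open>f \<circ> X\<^sub>1\<close> about the point \<open>f x\<close>, so it is the variance plus the squared distance of the mean
  from that point: \<open>D x = (P(f\<^sup>2) - P(f)\<^sup>2) x + (P(f) x - f x)\<^sup>2\<close>
  (\<open>second_moment_about_point\<close>). Both summands are nonnegative, so finiteness of the energy
  makes each of them integrable, and integrating the identity gives the formula.

  Finite energy is also the source of all pointwise integrability: it forces \<open>D x < \<infinity>\<close> for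
  almost every \<open>x\<close>, and then \<open>f\<close> is square integrable under the probability measure
  \<open>P(x, dy)\<close>. For this, and for splitting the integral, one needs \<open>x \<mapsto> D x\<close> and
  \<open>x \<mapsto> P(f) x\<close> to be measurable. The fibre measures \<open>\<rho>\<^sub>x\<close> can have infinite mass
  on a null set and their masses need not be bounded, so measurability is derived from the normalised
  family \<open>P(x, dy)\<close>, which is a subprobability kernel on all of \<open>V\<close>
  (\<open>transition_measurable\<close>).\<close>

section \<open>Second moments on a probability space\<close>

text \<open>On a probability space, this is the bias-variance decomposition of the second moment of
  \<open>g\<close> about \<open>a\<close>. Its finiteness already puts \<open>g\<close> in \<open>L\<^sup>2\<close>, because
  constants are square integrable and \<open>g = (g - a) + a\<close>.\<close>

lemma (in prob_space) second_moment_about_point: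
  fixes g :: "'a \<Rightarrow> real" and a :: real
  assumes [measurable]: "g \<in> borel_measurable M"
    and fin: "(\<integral>\<^sup>+ y. ennreal ((a - g y)\<^sup>2) \<partial>M) < \<infinity>"
  shows "integrable M g" "integrable M (\<lambda>y. (g y)\<^sup>2)"
    and "expectation (\<lambda>y. (g y)\<^sup>2) - (expectation g)\<^sup>2 \<ge> 0"
    and "(\<integral>\<^sup>+ y. ennreal ((a - g y)\<^sup>2) \<partial>M) =
      ennreal (expectation (\<lambda>y. (g y)\<^sup>2) - (expectation g)\<^sup>2 + (expectation g - a)\<^sup>2)"
proof -
  have sq: "integrable M (\<lambda>y. (a - g y)\<^sup>2)"
    using fin by (intro integrableI_nonneg) auto
  have "integrable M (\<lambda>y. a - g y)"
    by (rule square_integrable_imp_integrable[OF _ sq]) simp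
  from Bochner_Integration.integrable_diff[OF integrable_const[of a] this]
  show g: "integrable M g"
    unfolding diff_diff_eq2 add_diff_cancel_left' .
  have "integrable M (\<lambda>y. (a - g y)\<^sup>2 - a\<^sup>2 + 2 * a * g y)"
    using sq g by simp
  then show g2: "integrable M (\<lambda>y. (g y)\<^sup>2)"
    by (simp add: power2_diff algebra_simps)
  show "expectation (\<lambda>y. (g y)\<^sup>2) - (expectation g)\<^sup>2 \<ge> 0"
    using variance_positive[of g] variance_eq[OF g g2] by simp
  have "expectation (\<lambda>y. (a - g y)\<^sup>2) =
      expectation (\<lambda>y. (g y)\<^sup>2) - (expectation g)\<^sup>2 + (expectation g - a)\<^sup>2"
    using g g2 by (simp add: power2_diff prob_space)
  then show "(\<integral>\<^sup>+ y. ennreal ((a - g y)\<^sup>2) \<partial>M) =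
      ennreal (expectation (\<lambda>y. (g y)\<^sup>2) - (expectation g)\<^sup>2 + (expectation g - a)\<^sup>2)"
    using nn_integral_eq_integral[OF sq] by simp
qed

section \<open>Measurability with respect to the completion\<close>

text \<open>The laws of the process agree with the transition measures only almost everywhere. The
  conditional variance is therefore a null-set modification of a measurable function, and it is the
  completion that makes such modifications measurable.\<close>

lemma AE_eq_borel_measurable_completion:
  assumes [measurable]: "g \<in> borel_measurable M"
    and eq: "AE x in M. h x = g x"
  shows "h \<in> borel_measurable (completion M)"
proof (rule measurableI)
  fix A :: "'b set" assume A: "A \<in> sets borel"
  have "g -` A \<inter> space M \<in> sets (completion M)"
    using A by (intro sets_completionI_sets measurable_sets[of g M borel]) auto
  moreover have "AE x in completion M. x \<in> g -` A \<inter> space M \<longleftrightarrow> x \<in> h -` A \<inter> space M"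
    using AE_completion[OF eq] by eventually_elim auto
  moreover have "h -` A \<inter> space M \<subseteq> space (completion M)"
    by simp
  ultimately have "h -` A \<inter> space M \<in> sets (completion M)"
    using completion.in_sets_AE by blast
  then show "h -` A \<inter> space (completion M) \<in> sets (completion M)"
    by simp
qed simp

section \<open>The transition kernel\<close>

context symmetric_disintegrated_measure
begin

lemma space_R: "x \<in> space \<mu> \<Longrightarrow> space (R x) = space \<mu>"
  using R_sets by (rule sets_eq_imp_space_eq)

lemma total_conductance_measurable [measurable]: "total_conductance R \<in> borel_measurable \<mu>"
proof -
  have "(\<lambda>x. emeasure (R x) (space \<mu>)) \<in> borel_measurable \<mu>"
    by (rule R_measurable) simp
  then show ?thesis
    by (rule measurable_cong[THEN iffD2, rotated]) (simp add: total_conductance_def space_R)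
qed

lemma prob_space_transition:
  assumes "0 < total_conductance R x" "total_conductance R x < \<infinity>"
  shows "prob_space (transition R x)"
proof
  show "emeasure (transition R x) (space (transition R x)) = 1"
    using assms
    by (simp add: transition_def space_scale_measure total_conductance_def[symmetric]
        divide_ennreal_def[symmetric] mult.commute less_top)
qed

text \<open>The mass bound holds at every point: where \<open>c(x)\<close> is \<open>0\<close> or \<open>\<infinity>\<close>, the transition
  measure vanishes, because \<open>\<rho>\<^sub>x\<close> does in the first case and the factor \<open>1 / c(x)\<close> does in
  the second.\<close>

lemma transition_measurable [measurable]: "transition R \<in> measurable \<mu> (subprob_algebra \<mu>)"
proof (rule measurable_subprob_algebra)
  fix x assume x: "x \<in> space \<mu>"
  show "sets (transition R x) = sets \<mu>"
    using x by (simp add: transition_def R_sets)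
  show "subprob_space (transition R x)"
  proof
    show "space (transition R x) \<noteq> {}"
      using x by (auto simp: transition_def space_scale_measure space_R)
    consider "total_conductance R x = 0" | "total_conductance R x = \<infinity>"
      | "0 < total_conductance R x" "total_conductance R x < \<infinity>"
      by (metis infinity_ennreal_def top.not_eq_extremum zero_less_iff_neq_zero)
    then show "emeasure (transition R x) (space (transition R x)) \<le> 1"
    proof cases
      case 3
      then show ?thesis
        using prob_space.emeasure_space_1[OF prob_space_transition] by simp
    qed (simp_all add: transition_def space_scale_measure total_conductance_def)
  qed
next
  fix A assume [measurable]: "A \<in> sets \<mu>"
  have [measurable]: "(\<lambda>x. emeasure (R x) A) \<in> borel_measurable \<mu>"
    by (rule R_measurable) simp
  show "(\<lambda>x. emeasure (transition R x) A) \<in> borel_measurable \<mu>"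
    by (simp add: transition_def)
qed

lemma borel_measurable_transition:
  "x \<in> space \<mu> \<Longrightarrow> borel_measurable (transition R x) = borel_measurable \<mu>"
  by (intro measurable_cong_sets) (auto simp: transition_def R_sets)

lemma markov_op_measurable [measurable]:
  assumes [measurable]: "f \<in> borel_measurable \<mu>"
  shows "markov_op R f \<in> borel_measurable \<mu>"
  unfolding markov_op_def by measurable

lemma nu_borel_measurable [simp]: "borel_measurable (nu \<mu> R) = borel_measurable \<mu>"
  by (intro measurable_cong_sets) (simp_all add: nu_def)

lemma AE_nuI:
  assumes "AE x in \<mu>. P x"
  shows "AE x in nu \<mu> R. P x"
  unfolding nu_def by (subst AE_density[OF total_conductance_measurable]) (use assms in auto)

section \<open>The energy as an integral of second moments\<close>

lemma nn_integral_transition_square_measurable: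
  assumes [measurable]: "f \<in> borel_measurable \<mu>"
  shows "(\<lambda>x. \<integral>\<^sup>+ y. ennreal ((f x - f y)\<^sup>2) \<partial>transition R x) \<in> borel_measurable \<mu>"
  by (rule nn_integral_measurable_subprob_algebra2[OF _ transition_measurable]) measurable

text \<open>The weight \<open>c(x)\<close> in \<open>\<nu>\<close> cancels the normalisation \<open>1 / c(x)\<close> of the transition
  measure, which turns the left-hand side into the disintegrated form of the energy integral.\<close>

lemma nn_integral_transition_square:
  assumes [measurable]: "f \<in> borel_measurable \<mu>"
  shows "(\<integral>\<^sup>+ x. (\<integral>\<^sup>+ y. ennreal ((f x - f y)\<^sup>2) \<partial>transition R x) \<partial>nu \<mu> R) = 2 * energy \<rho> f"
proof -
  have cancel: "AE x in \<mu>.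
      total_conductance R x * (\<integral>\<^sup>+ y. ennreal ((f x - f y)\<^sup>2) \<partial>transition R x) =
      (\<integral>\<^sup>+ y. ennreal ((f x - f y)\<^sup>2) \<partial>R x)"
    using conductance_pos_finite AE_space
  proof eventually_elim
    case (elim x)
    have "(\<lambda>y. ennreal ((f x - f y)\<^sup>2)) \<in> borel_measurable \<mu>"
      by measurable
    then have m: "(\<lambda>y. ennreal ((f x - f y)\<^sup>2)) \<in> borel_measurable (R x)"
      using measurable_cong_sets[OF R_sets[OF elim(2)] refl] by blast
    have "total_conductance R x * inverse (total_conductance R x) = 1"
      using elim(1) by (auto simp: divide_ennreal_def[symmetric])
    then show ?case
      unfolding transition_def nn_integral_scale_measure[OF m] mult.assoc[symmetric] by simp
  qed
  have "(\<integral>\<^sup>+ x. (\<integral>\<^sup>+ y. ennreal ((f x - f y)\<^sup>2) \<partial>transition R x) \<partial>nu \<mu> R) =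
      (\<integral>\<^sup>+ x. total_conductance R x * (\<integral>\<^sup>+ y. ennreal ((f x - f y)\<^sup>2) \<partial>transition R x) \<partial>\<mu>)"
    unfolding nu_def
    by (intro nn_integral_density nn_integral_transition_square_measurable) measurable
  also have "\<dots> = (\<integral>\<^sup>+ x. (\<integral>\<^sup>+ y. ennreal ((f x - f y)\<^sup>2) \<partial>R x) \<partial>\<mu>)"
    by (rule nn_integral_cong_AE[OF cancel])
  also have "\<dots> = (\<integral>\<^sup>+ (x, y). ennreal ((f x - f y)\<^sup>2) \<partial>\<rho>)"
    by (subst disintegration) simp_all
  also have "\<dots> = 2 * energy \<rho> f"
    by (simp add: energy_def mult.assoc[symmetric] ennreal_times_divide ennreal_divide_self)
  finally show ?thesis .
qed

text \<open>Since \<open>\<nu>\<close>-integrability of the inner integral makes it finite almost everywhere, the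
  pointwise decomposition about \<open>a = f x\<close> applies under almost every transition measure.\<close>

lemma AE_second_moment_transition:
  assumes [measurable]: "f \<in> borel_measurable \<mu>" and fin: "energy \<rho> f < \<infinity>"
  shows "AE x in nu \<mu> R. prob_space (transition R x) \<and>
    integrable (transition R x) f \<and> integrable (transition R x) (\<lambda>y. (f y)\<^sup>2) \<and>
    markov_op R (\<lambda>y. (f y)\<^sup>2) x - (markov_op R f x)\<^sup>2 \<ge> 0 \<and>
    (\<integral>\<^sup>+ y. ennreal ((f x - f y)\<^sup>2) \<partial>transition R x) =
      ennreal (markov_op R (\<lambda>y. (f y)\<^sup>2) x - (markov_op R f x)\<^sup>2 + (markov_op R f x - f x)\<^sup>2)"
proof -
  let ?D = "\<lambda>x. \<integral>\<^sup>+ y. ennreal ((f x - f y)\<^sup>2) \<partial>transition R x"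
  have "AE x in nu \<mu> R. ?D x \<noteq> \<infinity>"
  proof (rule nn_integral_PInf_AE)
    show "?D \<in> borel_measurable (nu \<mu> R)"
      by (simp add: nn_integral_transition_square_measurable)
    show "(\<integral>\<^sup>+ x. ?D x \<partial>nu \<mu> R) \<noteq> \<infinity>"
      using fin by (simp add: nn_integral_transition_square ennreal_mult_eq_top_iff)
  qed
  with AE_nuI[OF conductance_pos_finite] AE_nuI[OF AE_space] show ?thesis
  proof eventually_elim
    case (elim x)
    interpret P: prob_space "transition R x"
      using elim(1) by (intro prob_space_transition) auto
    have f: "f \<in> borel_measurable (transition R x)"
      using elim(2) by (simp add: borel_measurable_transition)
    have D: "?D x < \<infinity>"
      using elim(3) by (simp add: less_top)
    show ?case
      unfolding markov_op_def
      using P.second_moment_about_point[OF f D] P.prob_space_axioms by blast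
  qed
qed

text \<open>The sum of the two nonnegative terms is integrable because its integral is twice the
  energy; each term is dominated by the sum.\<close>

lemma integrable_variance_and_bias:
  assumes [measurable]: "f \<in> borel_measurable \<mu>" and fin: "energy \<rho> f < \<infinity>"
  defines "V \<equiv> \<lambda>x. markov_op R (\<lambda>y. (f y)\<^sup>2) x - (markov_op R f x)\<^sup>2"
    and "W \<equiv> \<lambda>x. (markov_op R f x - f x)\<^sup>2"
  shows "integrable (nu \<mu> R) V" "integrable (nu \<mu> R) W"
    and "(energy_norm \<rho> f)\<^sup>2 = 1 / 2 * ((\<integral>x. V x \<partial>nu \<mu> R) + (\<integral>x. W x \<partial>nu \<mu> R))"
proof -
  have mV: "V \<in> borel_measurable (nu \<mu> R)" and mW: "W \<in> borel_measurable (nu \<mu> R)"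
    unfolding V_def W_def nu_borel_measurable by measurable
  note ae = AE_second_moment_transition[OF assms(1,2), folded V_def W_def]
  have V0: "AE x in nu \<mu> R. 0 \<le> V x"
    using ae by eventually_elim (simp add: V_def)
  have W0: "0 \<le> W x" for x
    by (simp add: W_def)
  have VW0: "AE x in nu \<mu> R. 0 \<le> V x + W x"
    using V0 by eventually_elim (simp add: W0)
  have "(\<integral>\<^sup>+ x. ennreal (V x + W x) \<partial>nu \<mu> R) =
      (\<integral>\<^sup>+ x. (\<integral>\<^sup>+ y. ennreal ((f x - f y)\<^sup>2) \<partial>transition R x) \<partial>nu \<mu> R)"
    by (rule nn_integral_cong_AE) (use ae in eventually_elim, simp add: V_def W_def)
  then have nn: "(\<integral>\<^sup>+ x. ennreal (V x + W x) \<partial>nu \<mu> R) = 2 * energy \<rho> f"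
    by (simp add: nn_integral_transition_square)
  have VW: "integrable (nu \<mu> R) (\<lambda>x. V x + W x)"
    using mV mW VW0 fin
    by (intro integrableI_nonneg) (auto simp: nn ennreal_mult_less_top)
  show iV: "integrable (nu \<mu> R) V"
    by (rule Bochner_Integration.integrable_bound[OF VW mV])
      (use V0 in eventually_elim, simp add: W0)
  show iW: "integrable (nu \<mu> R) W"
    by (rule Bochner_Integration.integrable_bound[OF VW mW])
      (use V0 in eventually_elim, simp add: W0)
  have "2 * energy \<rho> f = ennreal (\<integral>x. V x + W x \<partial>nu \<mu> R)"
    using nn nn_integral_eq_integral[OF VW VW0] by simp
  then have "2 * enn2real (energy \<rho> f) = (\<integral>x. V x + W x \<partial>nu \<mu> R)"
    using integral_nonneg_AE[OF VW0] by (metis enn2real_ennreal enn2real_mult enn2real_numeral)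
  then show "(energy_norm \<rho> f)\<^sup>2 = 1 / 2 * ((\<integral>x. V x \<partial>nu \<mu> R) + (\<integral>x. W x \<partial>nu \<mu> R))"
    using iV iW by (simp add: energy_norm_def)
qed

section \<open>The variance of the first step\<close>

lemma AE_first_step_variance:
  assumes fs: "first_step \<mu> R Pr X1"
    and [measurable]: "f \<in> borel_measurable \<mu>" and fin: "energy \<rho> f < \<infinity>"
  shows "AE x in nu \<mu> R. integrable (Pr x) (f \<circ> X1) \<and>
    integrable (Pr x) (\<lambda>\<omega>. ((f \<circ> X1) \<omega>)\<^sup>2) \<and>
    prob_space.variance (Pr x) (f \<circ> X1) = markov_op R (\<lambda>y. (f y)\<^sup>2) x - (markov_op R f x)\<^sup>2 \<and>
    markov_op R (\<lambda>y. (f y)\<^sup>2) x - (markov_op R f x)\<^sup>2 \<ge> 0"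
  using AE_nuI[OF fs[unfolded first_step_def]] AE_second_moment_transition[OF assms(2,3)]
proof eventually_elim
  case (elim x)
  interpret Pr: prob_space "Pr x"
    using elim(1) by simp
  have X1: "X1 \<in> measurable (Pr x) \<mu>" and law: "distr (Pr x) \<mu> X1 = transition R x"
    using elim(1) by auto
  have f2: "(\<lambda>y. (f y)\<^sup>2) \<in> borel_measurable \<mu>"
    by measurable
  have i: "integrable (Pr x) (f \<circ> X1)" and i2: "integrable (Pr x) (\<lambda>\<omega>. ((f \<circ> X1) \<omega>)\<^sup>2)"
    using elim(2) integrable_distr_eq[OF X1 assms(2)] integrable_distr_eq[OF X1 f2]
    by (simp_all add: law comp_def)
  have mean: "Pr.expectation (f \<circ> X1) = markov_op R f x"
    and second: "Pr.expectation (\<lambda>\<omega>. ((f \<circ> X1) \<omega>)\<^sup>2) = markov_op R (\<lambda>y. (f y)\<^sup>2) x"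
    using integral_distr[OF X1 assms(2)] integral_distr[OF X1 f2]
    by (simp_all add: markov_op_def law comp_def)
  have "Pr.variance (f \<circ> X1) = markov_op R (\<lambda>y. (f y)\<^sup>2) x - (markov_op R f x)\<^sup>2"
    using Pr.variance_eq[OF i i2] unfolding second mean .
  moreover have "markov_op R (\<lambda>y. (f y)\<^sup>2) x - (markov_op R f x)\<^sup>2 \<ge> 0"
    using elim(2) by simp
  ultimately show ?case
    using i i2 by (intro conjI)
qed

end

theorem theorem6p14:
  fixes \<mu> :: "'a measure" and \<rho> :: "('a \<times> 'a) measure" and E :: "('a \<times> 'a) set"
    and R :: "'a \<Rightarrow> 'a measure" and Pr :: "'a \<Rightarrow> 'w measure" and X1 :: "'w \<Rightarrow> 'a"
    and f :: "'a \<Rightarrow> real"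
  assumes "symmetric_disintegrated_measure \<mu> \<rho> E R"
    and "first_step \<mu> R Pr X1"
    and "f \<in> finite_energy_space \<mu> \<rho>"
  shows "let P = markov_op R; \<nu> = nu \<mu> R in
    (AE x in \<nu>. integrable (transition R x) f \<and> integrable (transition R x) (\<lambda>y. (f y)\<^sup>2)) \<and>
    integrable \<nu> (\<lambda>x. P (\<lambda>y. (f y)\<^sup>2) x - (P f x)\<^sup>2) \<and>
    integrable \<nu> (\<lambda>x. (P f x - f x)\<^sup>2) \<and>
    (\<lambda>x. f x - P f x) \<in> borel_measurable \<nu> \<and>
    (\<integral>x. (P (\<lambda>y. (f y)\<^sup>2) x - (P f x)\<^sup>2) \<partial>\<nu>) \<ge> 0 \<and>
    (\<integral>x. (P f x - f x)\<^sup>2 \<partial>\<nu>) \<ge> 0 \<and>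
    (energy_norm \<rho> f)\<^sup>2 =
      1 / 2 * ((\<integral>x. (P (\<lambda>y. (f y)\<^sup>2) x - (P f x)\<^sup>2) \<partial>\<nu>) + (\<integral>x. (P f x - f x)\<^sup>2 \<partial>\<nu>)) \<and>
    (energy_norm \<rho> f)\<^sup>2 =
      1 / 2 * ((\<integral>x. (P (\<lambda>y. (f y)\<^sup>2) x - (P f x)\<^sup>2) \<partial>\<nu>) +
        (L2_norm \<nu> (\<lambda>x. f x - P f x))\<^sup>2) \<and>
    (AE x in \<nu>. integrable (Pr x) (f \<circ> X1) \<and> integrable (Pr x) (\<lambda>\<omega>. ((f \<circ> X1) \<omega>)\<^sup>2) \<and>
      prob_space.variance (Pr x) (f \<circ> X1) = P (\<lambda>y. (f y)\<^sup>2) x - (P f x)\<^sup>2 \<and>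
      P (\<lambda>y. (f y)\<^sup>2) x - (P f x)\<^sup>2 \<ge> 0) \<and>
    integrable (completion \<nu>) (\<lambda>x. prob_space.variance (Pr x) (f \<circ> X1))"
proof -
  interpret symmetric_disintegrated_measure \<mu> \<rho> E R
    by (rule assms(1))
  have f [measurable]: "f \<in> borel_measurable \<mu>" and fin: "energy \<rho> f < \<infinity>"
    using assms(3) by (auto simp: finite_energy_space_def)
  let ?V = "\<lambda>x. markov_op R (\<lambda>y. (f y)\<^sup>2) x - (markov_op R f x)\<^sup>2"
  let ?W = "\<lambda>x. (markov_op R f x - f x)\<^sup>2"
  let ?Var = "\<lambda>x. prob_space.variance (Pr x) (f \<circ> X1)"
  note split = integrable_variance_and_bias[OF f fin]
  note ae = AE_second_moment_transition[OF f fin]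
  note step = AE_first_step_variance[OF assms(2) f fin]
  have L2: "AE x in nu \<mu> R. integrable (transition R x) f \<and>
      integrable (transition R x) (\<lambda>y. (f y)\<^sup>2)"
    using ae by eventually_elim blast
  have bias_measurable: "(\<lambda>x. f x - markov_op R f x) \<in> borel_measurable (nu \<mu> R)"
    unfolding nu_borel_measurable by measurable
  have V_nonneg: "(\<integral>x. ?V x \<partial>nu \<mu> R) \<ge> 0"
    by (rule integral_nonneg_AE) (use ae in eventually_elim, simp)
  have W_nonneg: "(\<integral>x. ?W x \<partial>nu \<mu> R) \<ge> 0"
    by simp
  have norm: "(L2_norm (nu \<mu> R) (\<lambda>x. f x - markov_op R f x))\<^sup>2 = (\<integral>x. ?W x \<partial>nu \<mu> R)"
    using W_nonneg by (simp add: L2_norm_def power2_commute[of "f _"])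
  have eq: "AE x in nu \<mu> R. ?Var x = ?V x"
    using step by eventually_elim blast
  have mVar: "?Var \<in> borel_measurable (completion (nu \<mu> R))"
    by (rule AE_eq_borel_measurable_completion[OF borel_measurable_integrable[OF split(1)] eq])
  have "integrable (completion (nu \<mu> R)) ?V"
    using split(1) by (simp add: integrable_completion borel_measurable_integrable)
  then have "integrable (completion (nu \<mu> R)) ?Var"
    by (rule integrable_cong_AE_imp[OF _ mVar])
      (use AE_completion[OF eq] in eventually_elim, simp)
  then show ?thesis
    unfolding Let_def norm
    using L2 split bias_measurable V_nonneg W_nonneg step by (intro conjI)
qed

end
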